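(* Let $BES=\langle\mathcal{B},\mathcal{R}\rangle$ be a Boolean evolution system with unknown variables $b_1,\dots,b_{n_1}$ and known variables $b_{n_1+1},\dots,b_n$, and let $\mathcal{M}$ be its transition system. The second category of inconsistency can be checked by the CTL formula $$AG\big(\neg(\mathtt{B}_{n_1+1}\land EX\,\mathtt{D}_{n_1+1})\land\neg(\mathtt{D}_{n_1+1}\land EX\,\mathtt{B}_{n_1+1})\land\cdots\land\neg(\mathtt{B}_n\land EX\,\mathtt{D}_n)\land\neg(\mathtt{D}_n\land EX\,\mathtt{B}_n)\big)$$ or the LTL formula $$\Box\big(\neg(\mathtt{B}_{n_1+1}\land\bigcirc\mathtt{D}_{n_1+1})\land\neg(\mathtt{D}_{n_1+1}\land\bigcirc\mathtt{B}_{n_1+1})\land\cdots\land\neg(\mathtt{B}_n\land\bigcirc\mathtt{D}_n)\land\neg(\mathtt{D}_n\land\bigcirc\mathtt{B}_n)\big),$$ that is, for each of these two formulas, the formula holds in $\mathcal{M}$ (at all initial states) if and only if the second category of inconsistency does not occur in $BES$.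
   Context: A Boolean evolution system $BES=\langle\mathcal{B},\mathcal{R}\rangle$ consists of a finite set of variables $\mathcal{B}=\{b_1,\dots,b_n\}$, $n=n_1+n_2$, with $\mathcal{B}^{unknown}=\{b_1,\dots,b_{n_1}\}$ and $\mathcal{B}^{known}=\{b_{n_1+1},\dots,b_{n_1+n_2}\}$, and a finite set $\mathcal{R}$ of rules, each of the form $g\to b$ (assign $true$ to $b$) or $g\to\neg b$ (assign $false$ to $b$), where $g$ (the guard) is a Boolean formula over $\mathcal{B}$ and $b\in\mathcal{B}$. A valuation gives each known variable a value in $\{true,false\}$ and each unknown variable a value in $\{true,false,unknown\}$. Guards are evaluated to $true$, $false$ or $unknown$ (strong Kleene three-valued logic); a rule is enabled at a valuation if its guard evaluates to $true$. It is assumed that at each valuation the set of enabled rules is non-empty. The transition system $\mathcal{M}=\langle S,S_0,T,A,H\rangle$ of $BES$: $S$ is the set of all $3^{n_1}\cdot 2^{n_2}$ valuations; $S_0$ is the set of the $2^{n_2}$ valuations in which all unknown variables have value $unknown$; $(s,s')\in T$ iff $s'$ results from $s$ by simultaneously applying all enabled rules (synchronous semantics): for each variable $b$, $s'(b)=s(b)$ if no enabled rule assigns $b$; $s'(b)=true$ (resp. $false$) if some enabled rule is of the form $g\to b$ (resp. $g\to\neg b$) and no enabled rule assigns the opposite value; and if enabled rules of both forms exist for $b$, then $s'(b)$ may be either $true$ or $false$ (so $k$ conflicting variables give $2^k$ successors). Atomic propositions include $\mathtt{B}_i$, holding in $s$ iff $s(b_i)=true$, and $\mathtt{D}_i$,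 holding in $s$ iff $s(b_i)=false$; $H(s)$ is the set of atomic propositions valid in $s$. Second category of inconsistency: a variable in $\mathcal{B}^{known}$ is updated to the opposite value of its initial value at some time during an evolution starting from an initial state. CTL has the standard semantics. Satisfaction of LTL at a state is defined in the paper recursively by: $s\models p$ iff $p\in H(s)$; $s\models\neg\varphi$ iff not $s\models\varphi$; $s\models\varphi_1\land\varphi_2$ iff both hold at $s$; $s\models\bigcirc\varphi$ (resp. $\Box\varphi$, $\Diamond\varphi$) iff for all paths $\rho$ starting at $s$, $\rho(1)\models\varphi$ (resp. $\rho(i)\models\varphi$ for all $i\ge 0$; there exists $i\ge0$ with $\rho(i)\models\varphi$). Paths are infinite sequences of states with consecutive states related by $T$. A formula holds in $\mathcal{M}$ if it is satisfied at every state of $S_0$; the paper adds that an LTL formula $\varphi$ holding in the model means that every path from every initial state has to satisfy $\varphi$.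
   Formalization: LTL is interpreted along paths, with one outer quantifier over all paths from initial states, not by the recursive clauses at states; under those the LTL half fails for one known variable b with rules true→b and true→¬b. *)

theory Defs
  imports Main "HOL-Library.FuncSet"
begin

datatype tval = TT | FF | UU

fun kleene_not :: "tval \<Rightarrow> tval" where
  "kleene_not TT = FF"
| "kleene_not FF = TT"
| "kleene_not UU = UU"

fun kleene_and :: "tval \<Rightarrow> tval \<Rightarrow> tval" where
  "kleene_and FF _ = FF"
| "kleene_and _ FF = FF"
| "kleene_and TT TT = TT"
| "kleene_and _ _ = UU"

fun kleene_or :: "tval \<Rightarrow> tval \<Rightarrow> tval" where
  "kleene_or TT _ = TT"
| "kleene_or _ TT = TT"
| "kleene_or FF FF = FF"
| "kleene_or _ _ = UU"

datatype bform =
    BConst bool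
  | BVar nat
  | BNot bform
  | BAnd bform bform
  | BOr bform bform

fun bvars :: "bform \<Rightarrow> nat set" where
  "bvars (BConst c) = {}"
| "bvars (BVar i) = {i}"
| "bvars (BNot g) = bvars g"
| "bvars (BAnd g h) = bvars g \<union> bvars h"
| "bvars (BOr g h) = bvars g \<union> bvars h"

type_synonym valuation = "nat \<Rightarrow> tval"

fun beval :: "valuation \<Rightarrow> bform \<Rightarrow> tval" where
  "beval s (BConst c) = (if c then TT else FF)"
| "beval s (BVar i) = s i"
| "beval s (BNot g) = kleene_not (beval s g)"
| "beval s (BAnd g h) = kleene_and (beval s g) (beval s h)"
| "beval s (BOr g h) = kleene_or (beval s g) (beval s h)"

text \<open>The variable \<open>b\<^sub>i\<close> is represented by its index \<open>i\<close>, counted from 1.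
  \<open>Assign g i True\<close> is the rule \<open>g \<rightarrow> b\<^sub>i\<close> and \<open>Assign g i False\<close>
  is the rule \<open>g \<rightarrow> \<not> b\<^sub>i\<close>.\<close>

datatype brule = Assign (guard: bform) (target: nat) (assigned: bool)

record bes =
  n_unknown :: nat
  n_known :: nat
  rules :: "brule set"

definition unknown_vars :: "bes \<Rightarrow> nat set" where
  "unknown_vars E = {1..n_unknown E}"

definition known_vars :: "bes \<Rightarrow> nat set" where
  "known_vars E = {n_unknown E + 1..n_unknown E + n_known E}"

definition vars :: "bes \<Rightarrow> nat set" where
  "vars E = unknown_vars E \<union> known_vars E"

text \<open>Valuations are extensional (\<open>undefined\<close> outside the variables), so that
  distinct functions are distinct valuations; see the cardinality lemmas below.\<close>

definition valuations :: "bes \<Rightarrow> valuation set" where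
  "valuations E = (\<Pi>\<^sub>E i\<in>vars E. if i \<in> unknown_vars E then {TT, FF, UU} else {TT, FF})"

definition initial_valuations :: "bes \<Rightarrow> valuation set" where
  "initial_valuations E = {s \<in> valuations E. \<forall>i\<in>unknown_vars E. s i = UU}"

definition enabled :: "bes \<Rightarrow> valuation \<Rightarrow> brule set" where
  "enabled E s = {r \<in> rules E. beval s (guard r) = TT}"

definition is_bes :: "bes \<Rightarrow> bool" where
  "is_bes E \<longleftrightarrow>
     finite (rules E) \<and>
     (\<forall>r\<in>rules E. bvars (guard r) \<subseteq> vars E \<and> target r \<in> vars E) \<and>
     (\<forall>s\<in>valuations E. enabled E s \<noteq> {})"

definition assigns :: "bes \<Rightarrow> valuation \<Rightarrow> nat \<Rightarrow> bool \<Rightarrow> bool" where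
  "assigns E s i c \<longleftrightarrow> (\<exists>r\<in>enabled E s. target r = i \<and> assigned r = c)"

definition next_values :: "bes \<Rightarrow> valuation \<Rightarrow> nat \<Rightarrow> tval set" where
  "next_values E s i =
     (if assigns E s i True \<and> assigns E s i False then {TT, FF}
      else if assigns E s i True then {TT}
      else if assigns E s i False then {FF}
      else {s i})"

definition transitions :: "bes \<Rightarrow> (valuation \<times> valuation) set" where
  "transitions E = {(s, s'). s \<in> valuations E \<and> s' \<in> valuations E \<and>
     (\<forall>i\<in>vars E. s' i \<in> next_values E s i)}"

record ('s, 'p) tsys =
  states :: "'s set"
  init :: "'s set"
  trans_rel :: "('s \<times> 's) set"
  props :: "'p set"
  label :: "'s \<Rightarrow> 'p set"

definition paths_from :: "('s, 'p) tsys \<Rightarrow> 's \<Rightarrow> (nat \<Rightarrow> 's) set" where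
  "paths_from M s = {\<rho>. \<rho> 0 = s \<and> (\<forall>k. (\<rho> k, \<rho> (Suc k)) \<in> trans_rel M)}"

datatype 'p ctl =
    CTrue
  | CProp 'p
  | CNot "'p ctl"
  | CAnd "'p ctl" "'p ctl"
  | CEX "'p ctl"
  | CAX "'p ctl"
  | CEF "'p ctl"
  | CAF "'p ctl"
  | CEG "'p ctl"
  | CAG "'p ctl"
  | CEU "'p ctl" "'p ctl"
  | CAU "'p ctl" "'p ctl"

fun ctl_sat :: "('s, 'p) tsys \<Rightarrow> 's \<Rightarrow> 'p ctl \<Rightarrow> bool" where
  "ctl_sat M s CTrue \<longleftrightarrow> True"
| "ctl_sat M s (CProp p) \<longleftrightarrow> p \<in> label M s"
| "ctl_sat M s (CNot \<phi>) \<longleftrightarrow> \<not> ctl_sat M s \<phi>"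
| "ctl_sat M s (CAnd \<phi> \<psi>) \<longleftrightarrow> ctl_sat M s \<phi> \<and> ctl_sat M s \<psi>"
| "ctl_sat M s (CEX \<phi>) \<longleftrightarrow> (\<exists>\<rho>\<in>paths_from M s. ctl_sat M (\<rho> 1) \<phi>)"
| "ctl_sat M s (CAX \<phi>) \<longleftrightarrow> (\<forall>\<rho>\<in>paths_from M s. ctl_sat M (\<rho> 1) \<phi>)"
| "ctl_sat M s (CEF \<phi>) \<longleftrightarrow> (\<exists>\<rho>\<in>paths_from M s. \<exists>k. ctl_sat M (\<rho> k) \<phi>)"
| "ctl_sat M s (CAF \<phi>) \<longleftrightarrow> (\<forall>\<rho>\<in>paths_from M s. \<exists>k. ctl_sat M (\<rho> k) \<phi>)"
| "ctl_sat M s (CEG \<phi>) \<longleftrightarrow> (\<exists>\<rho>\<in>paths_from M s. \<forall>k. ctl_sat M (\<rho> k) \<phi>)"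
| "ctl_sat M s (CAG \<phi>) \<longleftrightarrow> (\<forall>\<rho>\<in>paths_from M s. \<forall>k. ctl_sat M (\<rho> k) \<phi>)"
| "ctl_sat M s (CEU \<phi> \<psi>) \<longleftrightarrow>
     (\<exists>\<rho>\<in>paths_from M s. \<exists>k. ctl_sat M (\<rho> k) \<psi> \<and> (\<forall>j<k. ctl_sat M (\<rho> j) \<phi>))"
| "ctl_sat M s (CAU \<phi> \<psi>) \<longleftrightarrow>
     (\<forall>\<rho>\<in>paths_from M s. \<exists>k. ctl_sat M (\<rho> k) \<psi> \<and> (\<forall>j<k. ctl_sat M (\<rho> j) \<phi>))"

definition ctl_holds :: "('s, 'p) tsys \<Rightarrow> 'p ctl \<Rightarrow> bool" where
  "ctl_holds M \<phi> \<longleftrightarrow> (\<forall>s\<in>init M. ctl_sat M s \<phi>)"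

datatype 'p ltl =
    LTrue
  | LProp 'p
  | LNot "'p ltl"
  | LAnd "'p ltl" "'p ltl"
  | LNext "'p ltl"
  | LAlways "'p ltl"
  | LEventually "'p ltl"

text \<open>LTL formulas are interpreted along a path, and the universal quantification over
  paths is made once, outside the formula. Quantifying over all paths at every temporal
  operator instead would turn \<open>\<not> (B \<and> \<circle> D)\<close> into ``not every successor of a
  \<open>B\<close>-state is a \<open>D\<close>-state'', which a state with several successors can satisfy
  although one of its successors is a \<open>D\<close>-state.\<close>

fun ltl_sat :: "('s, 'p) tsys \<Rightarrow> (nat \<Rightarrow> 's) \<Rightarrow> 'p ltl \<Rightarrow> bool" where
  "ltl_sat M \<rho> LTrue \<longleftrightarrow> True"
| "ltl_sat M \<rho> (LProp p) \<longleftrightarrow> p \<in> label M (\<rho> 0)"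
| "ltl_sat M \<rho> (LNot \<phi>) \<longleftrightarrow> \<not> ltl_sat M \<rho> \<phi>"
| "ltl_sat M \<rho> (LAnd \<phi> \<psi>) \<longleftrightarrow> ltl_sat M \<rho> \<phi> \<and> ltl_sat M \<rho> \<psi>"
| "ltl_sat M \<rho> (LNext \<phi>) \<longleftrightarrow> ltl_sat M (\<lambda>j. \<rho> (1 + j)) \<phi>"
| "ltl_sat M \<rho> (LAlways \<phi>) \<longleftrightarrow> (\<forall>k. ltl_sat M (\<lambda>j. \<rho> (k + j)) \<phi>)"
| "ltl_sat M \<rho> (LEventually \<phi>) \<longleftrightarrow> (\<exists>k. ltl_sat M (\<lambda>j. \<rho> (k + j)) \<phi>)"

definition ltl_holds :: "('s, 'p) tsys \<Rightarrow> 'p ltl \<Rightarrow> bool" where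
  "ltl_holds M \<phi> \<longleftrightarrow> (\<forall>s\<in>init M. \<forall>\<rho>\<in>paths_from M s. ltl_sat M \<rho> \<phi>)"

datatype aprop = B nat | D nat

definition bes_props :: "bes \<Rightarrow> aprop set" where
  "bes_props E = B ` vars E \<union> D ` vars E"

fun valid_in :: "valuation \<Rightarrow> aprop \<Rightarrow> bool" where
  "valid_in s (B i) \<longleftrightarrow> s i = TT"
| "valid_in s (D i) \<longleftrightarrow> s i = FF"

definition bes_tsys :: "bes \<Rightarrow> (valuation, aprop) tsys" where
  "bes_tsys E =
     \<lparr> states = valuations E,
       init = initial_valuations E,
       trans_rel = transitions E,
       props = bes_props E,
       label = (\<lambda>s. {p \<in> bes_props E. valid_in s p}) \<rparr>"

text \<open>On the values \<open>TT\<close> and \<open>FF\<close> of a known variable, \<open>kleene_not\<close> gives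
  the opposite value.\<close>

definition second_inconsistency :: "bes \<Rightarrow> bool" where
  "second_inconsistency E \<longleftrightarrow>
     (\<exists>s\<in>init (bes_tsys E). \<exists>\<rho>\<in>paths_from (bes_tsys E) s.
        \<exists>i\<in>known_vars E. \<exists>k. \<rho> k i = kleene_not (s i))"

fun ctl_conj :: "'p ctl list \<Rightarrow> 'p ctl" where
  "ctl_conj [] = CTrue"
| "ctl_conj [\<phi>] = \<phi>"
| "ctl_conj (\<phi> # \<psi> # \<chi>s) = CAnd \<phi> (ctl_conj (\<psi> # \<chi>s))"

fun ltl_conj :: "'p ltl list \<Rightarrow> 'p ltl" where
  "ltl_conj [] = LTrue"
| "ltl_conj [\<phi>] = \<phi>"
| "ltl_conj (\<phi> # \<psi> # \<chi>s) = LAnd \<phi> (ltl_conj (\<psi> # \<chi>s))"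

definition known_list :: "bes \<Rightarrow> nat list" where
  "known_list E = [n_unknown E + 1..<n_unknown E + n_known E + 1]"

definition ctl_formula :: "bes \<Rightarrow> aprop ctl" where
  "ctl_formula E = CAG (ctl_conj (concat (map (\<lambda>i.
     [CNot (CAnd (CProp (B i)) (CEX (CProp (D i)))),
      CNot (CAnd (CProp (D i)) (CEX (CProp (B i))))]) (known_list E))))"

definition ltl_formula :: "bes \<Rightarrow> aprop ltl" where
  "ltl_formula E = LAlways (ltl_conj (concat (map (\<lambda>i.
     [LNot (LAnd (LProp (B i)) (LNext (LProp (D i)))),
      LNot (LAnd (LProp (D i)) (LNext (LProp (B i))))]) (known_list E))))"

lemma card_valuations: "card (valuations E) = 3 ^ n_unknown E * 2 ^ n_known E"
proof -
  have fin: "finite (unknown_vars E)" "finite (known_vars E)"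
    and dis: "unknown_vars E \<inter> known_vars E = {}"
    by (auto simp: unknown_vars_def known_vars_def)
  let ?c = "\<lambda>i. card (if i \<in> unknown_vars E then {TT, FF, UU} else {TT, FF})"
  have "card (valuations E) = prod ?c (unknown_vars E \<union> known_vars E)"
    unfolding valuations_def vars_def using fin by (subst card_PiE) auto
  also have "\<dots> = prod ?c (unknown_vars E) * prod ?c (known_vars E)"
    using fin dis by (rule prod.union_disjoint)
  also have "prod ?c (unknown_vars E) = (\<Prod>i\<in>unknown_vars E. 3)"
    by (rule prod.cong) auto
  also have "prod ?c (known_vars E) = (\<Prod>i\<in>known_vars E. 2)"
    using dis by (intro prod.cong) auto
  finally show ?thesis by (simp add: unknown_vars_def known_vars_def)
qed

lemma card_initial_valuations: "card (initial_valuations E) = 2 ^ n_known E"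
proof -
  have fin: "finite (unknown_vars E)" "finite (known_vars E)"
    and dis: "unknown_vars E \<inter> known_vars E = {}"
    by (auto simp: unknown_vars_def known_vars_def)
  let ?A = "\<lambda>i. if i \<in> unknown_vars E then {UU} else {TT, FF}"
  let ?c = "\<lambda>i. card (?A i)"
  have "initial_valuations E = (\<Pi>\<^sub>E i\<in>unknown_vars E \<union> known_vars E. ?A i)"
    unfolding initial_valuations_def valuations_def vars_def
    by (rule set_eqI) (auto simp: PiE_iff split: if_splits)
  then have "card (initial_valuations E) = prod ?c (unknown_vars E \<union> known_vars E)"
    using fin by (simp add: card_PiE)
  also have "\<dots> = prod ?c (unknown_vars E) * prod ?c (known_vars E)"
    using fin dis by (rule prod.union_disjoint)
  also have "prod ?c (unknown_vars E) = 1"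
    by (rule prod.neutral) auto
  also have "prod ?c (known_vars E) = (\<Prod>i\<in>known_vars E. 2)"
    using dis by (intro prod.cong) auto
  finally show ?thesis by (simp add: known_vars_def)
qed

end

(* A known variable is two-valued along every path, so it leaves its initial value iff it flips
   between two consecutive states; the LTL formula forbids exactly these flips. For the CTL formula,
   the path witnessing EX at a state of a path is spliced onto the prefix reaching that state, which
   turns a violation into a flip along a single path. *)

theory Submission imports Defs begin

lemma paths_from_shift:
  assumes "\<rho> \<in> paths_from M s"
  shows "(\<lambda>j. \<rho> (k + j)) \<in> paths_from M (\<rho> k)"
  using assms by (auto simp: paths_from_def)

text \<open>The tail of \<open>\<rho>\<close> from position \<open>k\<close> on is exchanged for
  \<open>\<sigma>\<close>. The seam is a transition because \<open>\<sigma>\<close> starts in the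
  very state \<open>\<rho> k\<close>.\<close>

lemma paths_from_splice:
  assumes "\<rho> \<in> paths_from M s" "\<sigma> \<in> paths_from M (\<rho> k)"
  shows "(\<lambda>j. if j < k then \<rho> j else \<sigma> (j - k)) \<in> paths_from M s"
proof -
  let ?\<tau> = "\<lambda>j. if j < k then \<rho> j else \<sigma> (j - k)"
  have \<rho>: "\<rho> 0 = s" "(\<rho> j, \<rho> (Suc j)) \<in> trans_rel M"
    and \<sigma>: "\<sigma> 0 = \<rho> k" "(\<sigma> j, \<sigma> (Suc j)) \<in> trans_rel M" for j
    using assms by (auto simp: paths_from_def)
  have "(?\<tau> j, ?\<tau> (Suc j)) \<in> trans_rel M" for j
  proof (cases "Suc j < k")
    case True
    then show ?thesis using \<rho> by simp
  next
    case False
    \<comment> \<open>Either the step crosses the seam, ending in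
      \<open>\<sigma> 0 = \<rho> k\<close>, or it lies entirely within
      \<open>\<sigma>\<close>.\<close>
    then consider "Suc j = k" | "k \<le> j" by linarith
    then show ?thesis
    proof cases
      case 1
      then show ?thesis using \<rho>(2)[of j] \<sigma>(1) by auto
    next
      case 2
      then show ?thesis using \<sigma>(2)[of "j - k"] by (simp add: Suc_diff_le)
    qed
  qed
  then show ?thesis using \<rho>(1) \<sigma>(1) by (auto simp: paths_from_def)
qed

lemma ctl_sat_conj: "ctl_sat M s (ctl_conj \<phi>s) \<longleftrightarrow> (\<forall>\<phi>\<in>set \<phi>s. ctl_sat M s \<phi>)"
  by (induction \<phi>s rule: ctl_conj.induct) auto

lemma ltl_sat_conj: "ltl_sat M \<rho> (ltl_conj \<phi>s) \<longleftrightarrow> (\<forall>\<phi>\<in>set \<phi>s. ltl_sat M \<rho> \<phi>)"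
  by (induction \<phi>s rule: ltl_conj.induct) auto

lemma set_known_list: "set (known_list E) = known_vars E"
  by (auto simp: known_list_def known_vars_def)

lemma label_bes_tsys:
  assumes "i \<in> known_vars E"
  shows "B i \<in> label (bes_tsys E) s \<longleftrightarrow> s i = TT" "D i \<in> label (bes_tsys E) s \<longleftrightarrow> s i = FF"
  using assms by (auto simp: bes_tsys_def bes_props_def vars_def)

lemma valuation_known:
  assumes "s \<in> valuations E" "i \<in> known_vars E"
  shows "s i \<in> {TT, FF}"
proof -
  have "i \<in> vars E" "i \<notin> unknown_vars E"
    using assms(2) by (auto simp: vars_def known_vars_def unknown_vars_def)
  then show ?thesis
    using PiE_mem[OF assms(1)[unfolded valuations_def], of i] by simp
qed

text \<open>Every state on an infinite path is the source of a transition, and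
  \<open>transitions\<close> relates only valuations, where known variables are two-valued.\<close>

lemma path_known:
  assumes "\<rho> \<in> paths_from (bes_tsys E) s" "i \<in> known_vars E"
  shows "\<rho> k i \<in> {TT, FF}"
proof -
  have "(\<rho> k, \<rho> (Suc k)) \<in> transitions E"
    using assms(1) by (auto simp: paths_from_def bes_tsys_def)
  then show ?thesis
    using valuation_known[OF _ assms(2)] by (auto simp: transitions_def)
qed

text \<open>The common currency of the proof: the two conjuncts for a known variable forbid exactly
  the two disjuncts here.\<close>

definition flips :: "valuation \<Rightarrow> valuation \<Rightarrow> nat \<Rightarrow> bool" where
  "flips s s' i \<longleftrightarrow> s i = TT \<and> s' i = FF \<or> s i = FF \<and> s' i = TT"

text \<open>Without a flip, a two-valued sequence is constant and never reaches the opposite value.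
  A flip exhibits both values, one of which is opposite to the initial one.\<close>

lemma opposite_iff_flips:
  assumes "\<And>k. \<rho> k i \<in> {TT, FF}"
  shows "(\<exists>k. \<rho> k i = kleene_not (\<rho> 0 i)) \<longleftrightarrow> (\<exists>k. flips (\<rho> k) (\<rho> (Suc k)) i)"
proof
  assume "\<exists>k. \<rho> k i = kleene_not (\<rho> 0 i)"
  then obtain k where k: "\<rho> k i = kleene_not (\<rho> 0 i)" ..
  show "\<exists>k. flips (\<rho> k) (\<rho> (Suc k)) i"
  proof (rule ccontr)
    assume no: "\<nexists>k. flips (\<rho> k) (\<rho> (Suc k)) i"
    have "\<rho> (Suc j) i = \<rho> j i" for j
      using no assms[of j] assms[of "Suc j"] unfolding flips_def by auto
    then have "\<rho> j i = \<rho> 0 i" for j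
      by (induction j) simp_all
    \<comment> \<open>The only fixed point of \<open>kleene_not\<close> is \<open>UU\<close>, which
      is excluded at position 0.\<close>
    then show False using k assms[of 0] by auto
  qed
next
  assume "\<exists>k. flips (\<rho> k) (\<rho> (Suc k)) i"
  then obtain k where "flips (\<rho> k) (\<rho> (Suc k)) i" ..
  then have "\<rho> k i = kleene_not (\<rho> 0 i) \<or> \<rho> (Suc k) i = kleene_not (\<rho> 0 i)"
    using assms[of 0] unfolding flips_def by auto
  then show "\<exists>k. \<rho> k i = kleene_not (\<rho> 0 i)" by blast
qed

lemma second_inconsistency_iff_flips:
  "second_inconsistency E \<longleftrightarrow>
     (\<exists>s\<in>init (bes_tsys E). \<exists>\<rho>\<in>paths_from (bes_tsys E) s.
        \<exists>k. \<exists>i\<in>known_vars E. flips (\<rho> k) (\<rho> (Suc k)) i)"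
proof -
  have "(\<exists>k. \<rho> k i = kleene_not (s i)) \<longleftrightarrow> (\<exists>k. flips (\<rho> k) (\<rho> (Suc k)) i)"
    if "\<rho> \<in> paths_from (bes_tsys E) s" "i \<in> known_vars E" for s \<rho> i
  proof -
    have "\<rho> 0 = s" using that(1) by (simp add: paths_from_def)
    then show ?thesis
      using opposite_iff_flips[of \<rho> i, OF path_known[OF that]] by simp
  qed
  then show ?thesis unfolding second_inconsistency_def by blast
qed

lemma ltl_holds_formula:
  "ltl_holds (bes_tsys E) (ltl_formula E) \<longleftrightarrow>
     (\<forall>s\<in>init (bes_tsys E). \<forall>\<rho>\<in>paths_from (bes_tsys E) s.
        \<forall>k. \<forall>i\<in>known_vars E. \<not> flips (\<rho> k) (\<rho> (Suc k)) i)"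
  by (simp add: ltl_holds_def ltl_formula_def ltl_sat_conj set_known_list label_bes_tsys
      ball_conj_distrib flips_def)

text \<open>The \<open>CEX\<close> inside \<open>CAG\<close> chooses its own path
  \<open>\<sigma>\<close> from \<open>\<rho> k\<close>, so the flip need not lie along
  \<open>\<rho>\<close>, in contrast to \<open>LNext\<close>, which reads the same path.\<close>

lemma ctl_holds_formula:
  "ctl_holds (bes_tsys E) (ctl_formula E) \<longleftrightarrow>
     (\<forall>s\<in>init (bes_tsys E). \<forall>\<rho>\<in>paths_from (bes_tsys E) s. \<forall>k.
        \<forall>i\<in>known_vars E. \<forall>\<sigma>\<in>paths_from (bes_tsys E) (\<rho> k). \<not> flips (\<rho> k) (\<sigma> 1) i)"
  unfolding ctl_holds_def ctl_formula_def flips_def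
  by (simp add: ctl_sat_conj set_known_list label_bes_tsys) blast

lemma flips_branching_iff_linear:
  "(\<exists>\<rho>\<in>paths_from M s. \<exists>k. \<exists>\<sigma>\<in>paths_from M (\<rho> k). flips (\<rho> k) (\<sigma> 1) i) \<longleftrightarrow>
   (\<exists>\<rho>\<in>paths_from M s. \<exists>k. flips (\<rho> k) (\<rho> (Suc k)) i)"
proof
  assume "\<exists>\<rho>\<in>paths_from M s. \<exists>k. \<exists>\<sigma>\<in>paths_from M (\<rho> k). flips (\<rho> k) (\<sigma> 1) i"
  then obtain \<rho> k \<sigma> where *: "\<rho> \<in> paths_from M s" "\<sigma> \<in> paths_from M (\<rho> k)"
    "flips (\<rho> k) (\<sigma> 1) i" by blast
  let ?\<tau> = "\<lambda>j. if j < k then \<rho> j else \<sigma> (j - k)"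
  have "\<sigma> 0 = \<rho> k" using *(2) by (simp add: paths_from_def)
  \<comment> \<open>At the seam \<open>?\<tau> k\<close> is \<open>\<sigma> 0\<close> and
    \<open>?\<tau> (Suc k)\<close> is \<open>\<sigma> 1\<close>.\<close>
  then have "flips (?\<tau> k) (?\<tau> (Suc k)) i" using *(3) by simp
  then show "\<exists>\<rho>\<in>paths_from M s. \<exists>k. flips (\<rho> k) (\<rho> (Suc k)) i"
    using paths_from_splice[OF *(1,2)] by (intro bexI[of _ ?\<tau>] exI[of _ k])
next
  assume "\<exists>\<rho>\<in>paths_from M s. \<exists>k. flips (\<rho> k) (\<rho> (Suc k)) i"
  then obtain \<rho> k where *: "\<rho> \<in> paths_from M s" "flips (\<rho> k) (\<rho> (Suc k)) i"
    by blast
  show "\<exists>\<rho>\<in>paths_from M s. \<exists>k. \<exists>\<sigma>\<in>paths_from M (\<rho> k). flips (\<rho> k) (\<sigma> 1) i"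
    \<comment> \<open>The tail of \<open>\<rho>\<close> itself serves as the branching path
      \<open>\<sigma>\<close>.\<close>
    using * paths_from_shift[OF *(1), of k]
    by (intro bexI[of _ \<rho>] exI[of _ k] bexI[of _ "\<lambda>j. \<rho> (k + j)"]) simp_all
qed

theorem lemma2:
  fixes E :: bes
  assumes "is_bes E"
  shows "(ctl_holds (bes_tsys E) (ctl_formula E) \<longleftrightarrow> \<not> second_inconsistency E) \<and>
         (ltl_holds (bes_tsys E) (ltl_formula E) \<longleftrightarrow> \<not> second_inconsistency E)"
proof
  show "ctl_holds (bes_tsys E) (ctl_formula E) \<longleftrightarrow> \<not> second_inconsistency E"
    \<comment> \<open>The equivalence is available for each start state and variable separately;
      \<open>blast\<close> carries it through the quantifiers over both.\<close>
    using flips_branching_iff_linear[of "bes_tsys E"]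
    unfolding ctl_holds_formula second_inconsistency_iff_flips by blast
  show "ltl_holds (bes_tsys E) (ltl_formula E) \<longleftrightarrow> \<not> second_inconsistency E"
    unfolding ltl_holds_formula second_inconsistency_iff_flips by blast
qed

end
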